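(* Let $0<a_0<a_1<a_2$. No Liouville billiard table of the first type on the ellipsoid $E(a_0,a_1,a_2)$ is isometric to a Liouville billiard table of the second type on $E(a_0,a_1,a_2)$; that is, for all $\lambda\in(a_0,a_1)$ and $\mu\in(a_1,a_2)$ the Riemannian manifolds with boundary $X^\lambda$ and $X^\mu$ are not isometric.
   Context: $E(a_0,a_1,a_2)=\{(x_0,x_1,x_2)\in\mathbb{R}^3:\ \frac{x_0^2}{a_0}+\frac{x_1^2}{a_1}+\frac{x_2^2}{a_2}=1\}$ with the metric induced from the Euclidean metric of $\mathbb{R}^3$. Put $Q_\lambda=\frac{x_0^2}{a_0-\lambda}+\frac{x_1^2}{a_1-\lambda}+\frac{x_2^2}{a_2-\lambda}$. First type, $\lambda\in(a_0,a_1)$: $X^\lambda$ is either one of the two (isometric) parts, $x_0>0$ or $x_0<0$, of $E\cap\{Q_\lambda\le1\}$, i.e. the part of $E$ in the interior of the hyperboloid of one sheet $Q_\lambda=1$. Second type, $\lambda\in(a_1,a_2)$: $X^\lambda$ is either one of the two (isometric) parts, $x_2>0$ or $x_2<0$, of $E\cap\{Q_\lambda\ge1\}$, i.e. the part of $E$ in the interior of the hyperboloid of two sheets $Q_\lambda=1$. All $X^\lambda$ carry the induced metric. *)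

theory Defs
  imports "HOL-Analysis.Analysis"
begin

text \<open>The set \<open>U\<close> in the first two definitions is meant to be open.\<close>

primrec C_k_on :: "nat \<Rightarrow> ('a::real_normed_vector \<Rightarrow> 'b::real_normed_vector) \<Rightarrow> 'a set \<Rightarrow> bool" where
  "C_k_on 0 f U \<longleftrightarrow> continuous_on U f"
| "C_k_on (Suc k) f U \<longleftrightarrow>
     f differentiable_on U \<and> (\<forall>v. C_k_on k (\<lambda>x. frechet_derivative f (at x) v) U)"

definition smooth_on_open :: "('a::real_normed_vector \<Rightarrow> 'b::real_normed_vector) \<Rightarrow> 'a set \<Rightarrow> bool" where
  "smooth_on_open f U \<longleftrightarrow> (\<forall>k. C_k_on k f U)"

text \<open>On an arbitrary subset, such as an embedded submanifold with boundary, a map is smooth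
  if near each point it is the restriction of a smooth map of the ambient space.\<close>

definition smooth_map_on :: "'a::real_normed_vector set \<Rightarrow> ('a \<Rightarrow> 'b::real_normed_vector) \<Rightarrow> bool" where
  "smooth_map_on S f \<longleftrightarrow>
     (\<forall>p\<in>S. \<exists>U g. open U \<and> p \<in> U \<and> smooth_on_open g U \<and> (\<forall>x\<in>S \<inter> U. g x = f x))"

definition diffeomorphism_betw ::
    "'a::real_normed_vector set \<Rightarrow> 'b::real_normed_vector set \<Rightarrow> ('a \<Rightarrow> 'b) \<Rightarrow> bool" where
  "diffeomorphism_betw S T f \<longleftrightarrow>
     bij_betw f S T \<and> smooth_map_on S f \<and> smooth_map_on T (inv_into S f)"

text \<open>The tangent space of an embedded submanifold, possibly with boundary. At a boundary point the
  initial velocities of curves in \<open>S\<close> fill only a half-space, whence the linear span, which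
  is the full tangent space there too.\<close>

definition tangent_space :: "'a::real_normed_vector set \<Rightarrow> 'a \<Rightarrow> 'a set" where
  "tangent_space S p = span {v. \<exists>c e. 0 < e \<and> c (0::real) = p \<and> c ` {0..<e} \<subseteq> S \<and>
      smooth_map_on {0..<e} c \<and> (c has_vector_derivative v) (at 0 within {0..<e})}"

text \<open>Isometries for the Riemannian metrics induced by the ambient inner products.
  The derivative \<open>D\<close> of \<open>f\<close> within \<open>S\<close> exists because \<open>f\<close> is smooth; it may not be unique on the
  ambient space, but its restriction to the tangent space is, and is the differential of \<open>f\<close>.\<close>

definition riemannian_isometry ::
    "'a::real_inner set \<Rightarrow> 'b::real_inner set \<Rightarrow> ('a \<Rightarrow> 'b) \<Rightarrow> bool" where
  "riemannian_isometry S T f \<longleftrightarrow>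
     diffeomorphism_betw S T f \<and>
     (\<forall>p\<in>S. \<exists>D. (f has_derivative D) (at p within S) \<and>
        (\<forall>v\<in>tangent_space S p. \<forall>w\<in>tangent_space S p. D v \<bullet> D w = v \<bullet> w))"

definition riemannian_isometric :: "'a::real_inner set \<Rightarrow> 'b::real_inner set \<Rightarrow> bool" where
  "riemannian_isometric S T \<longleftrightarrow> (\<exists>f. riemannian_isometry S T f)"

text \<open>The coordinates \<open>(x\<^sub>0, x\<^sub>1, x\<^sub>2)\<close> are the components \<open>x $ 1\<close>, \<open>x $ 2\<close>, \<open>x $ 3\<close>.\<close>

definition ellipsoid :: "real \<Rightarrow> real \<Rightarrow> real \<Rightarrow> (real^3) set" where
  "ellipsoid a0 a1 a2 = {x. (x$1)\<^sup>2 / a0 + (x$2)\<^sup>2 / a1 + (x$3)\<^sup>2 / a2 = 1}"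

definition confocal_form :: "real \<Rightarrow> real \<Rightarrow> real \<Rightarrow> real \<Rightarrow> real^3 \<Rightarrow> real" where
  "confocal_form a0 a1 a2 l x = (x$1)\<^sup>2 / (a0 - l) + (x$2)\<^sup>2 / (a1 - l) + (x$3)\<^sup>2 / (a2 - l)"

text \<open>The two tables of the first type with parameter \<open>l \<in> {a0<..<a1}\<close>, and the two tables of the
  second type with parameter \<open>l \<in> {a1<..<a2}\<close>.\<close>

definition first_type_tables :: "real \<Rightarrow> real \<Rightarrow> real \<Rightarrow> real \<Rightarrow> (real^3) set set" where
  "first_type_tables a0 a1 a2 l =
     {{x \<in> ellipsoid a0 a1 a2. confocal_form a0 a1 a2 l x \<le> 1 \<and> x$1 > 0},
      {x \<in> ellipsoid a0 a1 a2. confocal_form a0 a1 a2 l x \<le> 1 \<and> x$1 < 0}}"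

definition second_type_tables :: "real \<Rightarrow> real \<Rightarrow> real \<Rightarrow> real \<Rightarrow> (real^3) set set" where
  "second_type_tables a0 a1 a2 l =
     {{x \<in> ellipsoid a0 a1 a2. confocal_form a0 a1 a2 l x \<ge> 1 \<and> x$3 > 0},
      {x \<in> ellipsoid a0 a1 a2. confocal_form a0 a1 a2 l x \<ge> 1 \<and> x$3 < 0}}"

end

theory Submission
  imports Defs
begin

text \<open>At a point \<open>x\<close> of the ellipsoid \<open>E(a\<^sub>0, a\<^sub>1, a\<^sub>2)\<close> the Gaussian curvature is
  \<open>1 / (a\<^sub>0 a\<^sub>1 a\<^sub>2 \<bar>A x\<bar>\<^sup>4)\<close>, where \<open>A = diag(1/a\<^sub>0, 1/a\<^sub>1, 1/a\<^sub>2)\<close>. It is smallest exactly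
  at the two points \<open>(\<plusminus>\<surd>a\<^sub>0, 0, 0)\<close>. A table of the first type contains one of them in its interior,
  while a table of the second type avoids the plane \<open>x\<^sub>2 = 0\<close> and hence both. By the Theorema
  Egregium an isometry preserves the curvature, so there is none between the two.\<close>

unbundle cross3_syntax

text \<open>The point comes last, so that \<open>dir_deriv f v\<close> is again a map and can be
  differentiated in turn.\<close>

abbreviation dir_deriv :: "('a::real_normed_vector \<Rightarrow> 'b::real_normed_vector) \<Rightarrow> 'a \<Rightarrow> 'a \<Rightarrow> 'b" where
  "dir_deriv f v x \<equiv> frechet_derivative f (at x) v"

subsection \<open>Symmetry of second derivatives\<close>

text \<open>Both mixed second derivatives are the limit of the second difference divided by \<open>h\<^sup>2\<close>.\<close>

lemma second_difference_bound:
  fixes f :: "'a::real_normed_vector \<Rightarrow> real"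
  assumes "open U" "p \<in> U" and f: "\<And>x. x \<in> U \<Longrightarrow> f differentiable (at x)"
    and L: "((\<lambda>x. dir_deriv f u x) has_derivative L) (at p)" and "e > 0"
  shows "\<exists>d>0. \<forall>h\<in>{0<..<d}.
    \<bar>f (p + h *\<^sub>R u + h *\<^sub>R v) - f (p + h *\<^sub>R u) - f (p + h *\<^sub>R v) + f p - h\<^sup>2 * L v\<bar> \<le> e * h\<^sup>2"
proof -
  define g where "g x = dir_deriv f u x" for x
  define M where "M = norm u + norm v + 1"
  have M: "M > 0" by (simp add: M_def add_nonneg_pos)
  interpret L: bounded_linear L using L by (rule has_derivative_bounded_linear)
  obtain r where r: "r > 0" "ball p r \<subseteq> U" using assms(1,2) openE by blast
  have "e / (2 * M) > 0" using M \<open>e > 0\<close> by simp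
  then obtain d' where d': "d' > 0"
    and gd: "\<And>y. norm (y - p) < d' \<Longrightarrow> norm (g y - g p - L (y - p)) \<le> e / (2 * M) * norm (y - p)"
    using L unfolding has_derivative_at_alt g_def by blast
  \<comment> \<open>For \<open>h < d\<close> every point \<open>p + t u + s v\<close> with
    \<open>t, s\<close> in \<open>[0, h]\<close> has distance at most \<open>h M < min d' r\<close>
    from \<open>p\<close>: it lies in \<open>U\<close> and where \<open>gd\<close> applies.\<close>
  define d where "d = min d' r / M"
  have dpos: "d > 0" using d' r M by (simp add: d_def)
  have "\<bar>f (p + h *\<^sub>R u + h *\<^sub>R v) - f (p + h *\<^sub>R u) - f (p + h *\<^sub>R v) + f p - h\<^sup>2 * L v\<bar> \<le> e * h\<^sup>2"
    if h: "0 < h" "h < d" for h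
  proof -
    have hM: "h * M < min d' r" using h M by (simp add: d_def field_simps)
    have small: "norm (t *\<^sub>R u + s *\<^sub>R v) \<le> h * M" if "t \<in> {0..h}" "s \<in> {0..h}" for t s
    proof -
      have "norm (t *\<^sub>R u + s *\<^sub>R v) \<le> t * norm u + s * norm v"
        using that norm_triangle_ineq[of "t *\<^sub>R u" "s *\<^sub>R v"] by simp
      also have "\<dots> \<le> h * norm u + h * norm v"
        using that by (intro add_mono mult_right_mono) auto
      also have "\<dots> \<le> h * M" using h by (simp add: M_def algebra_simps)
      finally show ?thesis .
    qed
    have inU: "p + (t *\<^sub>R u + s *\<^sub>R v) \<in> U" if "t \<in> {0..h}" "s \<in> {0..h}" for t s
    proof -
      have "dist p (p + w) = norm w" for w by (simp add: dist_norm)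
      then have "dist p (p + (t *\<^sub>R u + s *\<^sub>R v)) < r"
        using small[OF that] hM by simp
      then show ?thesis using r by auto
    qed
    \<comment> \<open>The second difference is \<open>\<phi> h - \<phi> 0\<close>. The mean value
      theorem in \<open>t\<close> turns it into \<open>h\<close> times a difference of two values of
      \<open>g\<close>, each compared with the linearization of \<open>g\<close> at
      \<open>p\<close>, the one point where \<open>g\<close> is known to be differentiable.\<close>
    define \<phi> where "\<phi> t = f (p + (t *\<^sub>R u + h *\<^sub>R v)) - f (p + (t *\<^sub>R u + 0 *\<^sub>R v))" for t
    have der: "((\<lambda>t. f (p + (t *\<^sub>R u + s *\<^sub>R v))) has_real_derivative g (p + (t *\<^sub>R u + s *\<^sub>R v))) (at t)"
      if "t \<in> {0..h}" "s \<in> {0..h}" for t s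
    proof -
      let ?q = "p + (t *\<^sub>R u + s *\<^sub>R v)"
      have D: "(f has_derivative frechet_derivative f (at ?q)) (at ?q)"
        using f[OF inU[OF that]] frechet_derivative_works by blast
      have "((\<lambda>t. f (p + (t *\<^sub>R u + s *\<^sub>R v))) has_derivative (\<lambda>y. frechet_derivative f (at ?q) (y *\<^sub>R u))) (at t)"
        by (rule has_derivative_compose[where f = "\<lambda>t. p + (t *\<^sub>R u + s *\<^sub>R v)" and g = f, OF _ D]) (auto intro!: derivative_eq_intros)
      moreover have "(\<lambda>y. frechet_derivative f (at ?q) (y *\<^sub>R u)) = (*) (frechet_derivative f (at ?q) u)"
        using linear_cmul[OF has_derivative_linear[OF D]] by (simp add: fun_eq_iff)
      ultimately show ?thesis unfolding has_field_derivative_def g_def by simp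
    qed
    have "\<exists>\<xi>. 0 < \<xi> \<and> \<xi> < h \<and> \<phi> h - \<phi> 0 = (h - 0) *
        (g (p + (\<xi> *\<^sub>R u + h *\<^sub>R v)) - g (p + (\<xi> *\<^sub>R u + 0 *\<^sub>R v)))"
    proof (rule MVT2)
      fix t assume "0 \<le> t" "t \<le> h"
      then show "(\<phi> has_real_derivative g (p + (t *\<^sub>R u + h *\<^sub>R v)) - g (p + (t *\<^sub>R u + 0 *\<^sub>R v))) (at t)"
        unfolding \<phi>_def using h by (intro derivative_intros der) auto
    qed (use h in auto)
    then obtain \<xi> where \<xi>: "0 < \<xi>" "\<xi> < h" and
      mvt: "\<phi> h - \<phi> 0 = h * (g (p + (\<xi> *\<^sub>R u + h *\<^sub>R v)) - g (p + (\<xi> *\<^sub>R u + 0 *\<^sub>R v)))" by auto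
    have est: "\<bar>g (p + (\<xi> *\<^sub>R u + s *\<^sub>R v)) - g p - L (\<xi> *\<^sub>R u + s *\<^sub>R v)\<bar> \<le> e / 2 * h"
      if "s \<in> {0..h}" for s
    proof -
      have sm: "norm (\<xi> *\<^sub>R u + s *\<^sub>R v) \<le> h * M" using small \<xi> that by auto
      then have "\<bar>g (p + (\<xi> *\<^sub>R u + s *\<^sub>R v)) - g p - L (\<xi> *\<^sub>R u + s *\<^sub>R v)\<bar>
          \<le> e / (2 * M) * norm (\<xi> *\<^sub>R u + s *\<^sub>R v)"
        using gd[of "p + (\<xi> *\<^sub>R u + s *\<^sub>R v)"] hM by simp
      also have "\<dots> \<le> e / (2 * M) * (h * M)"
        using sm M \<open>e > 0\<close> by (intro mult_left_mono) auto
      finally show ?thesis using M by simp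
    qed
    have "L (\<xi> *\<^sub>R u + h *\<^sub>R v) = L (\<xi> *\<^sub>R u + 0 *\<^sub>R v) + h * L v"
      by (simp add: L.add L.scaleR L.zero)
    with est[of h] est[of 0] h
    have "\<bar>g (p + (\<xi> *\<^sub>R u + h *\<^sub>R v)) - g (p + (\<xi> *\<^sub>R u + 0 *\<^sub>R v)) - h * L v\<bar> \<le> e * h"
      (is "\<bar>?Y\<bar> \<le> _")
      unfolding abs_le_iff by simp
    then have "h * \<bar>?Y\<bar> \<le> h * (e * h)"
      using h by (intro mult_left_mono) auto
    moreover have "\<phi> h - \<phi> 0 - h\<^sup>2 * L v = h * ?Y"
      unfolding mvt by (simp only: power2_eq_square right_diff_distrib mult.assoc)
    ultimately have "\<bar>\<phi> h - \<phi> 0 - h\<^sup>2 * L v\<bar> \<le> e * h\<^sup>2"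
      using h by (simp only: abs_mult abs_of_pos) (simp add: power2_eq_square mult_ac)
    moreover have "\<phi> h - \<phi> 0 = f (p + h *\<^sub>R u + h *\<^sub>R v) - f (p + h *\<^sub>R u) - f (p + h *\<^sub>R v) + f p"
      by (simp add: \<phi>_def add.assoc)
    ultimately show ?thesis by simp
  qed
  then show ?thesis using dpos by auto
qed

lemma frechet_derivative_symmetric_real:
  fixes f :: "'a::real_normed_vector \<Rightarrow> real"
  assumes "open U" "p \<in> U" "\<And>x. x \<in> U \<Longrightarrow> f differentiable (at x)"
    and u: "((\<lambda>x. dir_deriv f u x) has_derivative Lu) (at p)"
    and v: "((\<lambda>x. dir_deriv f v x) has_derivative Lv) (at p)"
  shows "Lu v = Lv u"
proof -
  have "\<bar>Lu v - Lv u\<bar> \<le> e" if "e > 0" for e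
  proof -
    have "e / 2 > 0" using that by simp
    obtain d1 where d1: "d1 > 0" "\<And>h. h \<in> {0<..<d1} \<Longrightarrow>
      \<bar>f (p + h *\<^sub>R u + h *\<^sub>R v) - f (p + h *\<^sub>R u) - f (p + h *\<^sub>R v) + f p - h\<^sup>2 * Lu v\<bar> \<le> e / 2 * h\<^sup>2"
      using second_difference_bound[OF assms(1-3) u \<open>e / 2 > 0\<close>] by blast
    obtain d2 where d2: "d2 > 0" "\<And>h. h \<in> {0<..<d2} \<Longrightarrow>
      \<bar>f (p + h *\<^sub>R v + h *\<^sub>R u) - f (p + h *\<^sub>R v) - f (p + h *\<^sub>R u) + f p - h\<^sup>2 * Lv u\<bar> \<le> e / 2 * h\<^sup>2"
      using second_difference_bound[OF assms(1-3) v \<open>e / 2 > 0\<close>] by blast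
    define h where "h = min d1 d2 / 2"
    have h: "h > 0" "h \<in> {0<..<d1}" "h \<in> {0<..<d2}" using d1 d2 by (auto simp: h_def min_def)
    \<comment> \<open>The second difference is symmetric in \<open>u\<close> and \<open>v\<close>,
      so both estimates concern the same number.\<close>
    have "p + h *\<^sub>R v + h *\<^sub>R u = p + h *\<^sub>R u + h *\<^sub>R v" by (simp add: add.commute add.left_commute)
    then have "\<bar>h\<^sup>2 * Lu v - h\<^sup>2 * Lv u\<bar> \<le> e * h\<^sup>2"
      using d1(2)[OF h(2)] d2(2)[OF h(3)] unfolding abs_le_iff by (simp only:) linarith
    moreover have "h\<^sup>2 * Lu v - h\<^sup>2 * Lv u = h\<^sup>2 * (Lu v - Lv u)"
      by (simp add: algebra_simps)
    ultimately have "h\<^sup>2 * \<bar>Lu v - Lv u\<bar> \<le> h\<^sup>2 * e"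
      by (simp add: abs_mult mult.commute)
    then show ?thesis using h by simp
  qed
  then have "\<bar>Lu v - Lv u\<bar> \<le> 0" by (rule field_le_epsilon) simp
  then show ?thesis by simp
qed

subsection \<open>Maps of class \<open>C\<^sup>k\<close>\<close>

lemma C_k_on_SucD:
  assumes "C_k_on (Suc k) f U" "open U" "x \<in> U"
  shows "(f has_derivative frechet_derivative f (at x)) (at x)"
  using assms by (auto simp: differentiable_on_eq_differentiable_at frechet_derivative_works)

lemma C_k_on_dir_deriv: "C_k_on (Suc k) f U \<Longrightarrow> C_k_on k (dir_deriv f v) U"
  by simp

lemma C_k_on_Suc_imp: "C_k_on (Suc k) f U \<Longrightarrow> open U \<Longrightarrow> C_k_on k f U"
proof (induction k arbitrary: f)
  case 0
  then show ?case by (simp add: differentiable_imp_continuous_on)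
next
  case (Suc k)
  have "f differentiable_on U" and "C_k_on (Suc k) (\<lambda>x. dir_deriv f v x) U" for v
    using Suc.prems(1) by (simp_all only: C_k_on.simps(2)[of "Suc k"])
  then have "C_k_on k (\<lambda>x. dir_deriv f v x) U" for v
    using Suc.IH Suc.prems(2) by blast
  with \<open>f differentiable_on U\<close> show ?case by simp
qed

lemma C_k_on_cong:
  assumes "open U" "\<And>x. x \<in> U \<Longrightarrow> f x = g x"
  shows "C_k_on k f U \<longleftrightarrow> C_k_on k g U"
  using assms(2)
proof (induction k arbitrary: f g)
  case 0
  then show ?case by (simp cong: continuous_on_cong)
next
  case (Suc k)
  have d: "f differentiable_on U \<longleftrightarrow> g differentiable_on U"
    using Suc.prems unfolding differentiable_on_def
    by (intro ball_cong refl iffI) (erule differentiable_transform_within[OF _ zero_less_one], auto)+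
  show ?case
  proof (cases "f differentiable_on U")
    case True
    have "frechet_derivative f (at x) = frechet_derivative g (at x)" if "x \<in> U" for x
      using True that Suc.prems assms(1)
      by (intro frechet_derivative_transform_within_open[of f x U])
        (auto simp: differentiable_on_eq_differentiable_at)
    then have "C_k_on k (\<lambda>x. dir_deriv f v x) U \<longleftrightarrow>
        C_k_on k (\<lambda>x. dir_deriv g v x) U" for v
      by (intro Suc.IH) auto
    then show ?thesis using d by simp
  qed (use d in simp)
qed

text \<open>Lets an induction on \<open>k\<close> work with an explicit formula for the derivative
  in place of \<open>frechet_derivative\<close>; the closure properties below are proved this
  way.\<close>

lemma C_k_on_SucI:
  assumes "open U" and d: "\<And>x. x \<in> U \<Longrightarrow> (f has_derivative f' x) (at x)"
    and f': "\<And>v. C_k_on k (\<lambda>x. f' x v) U"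
  shows "C_k_on (Suc k) f U"
proof -
  have "f' x v = dir_deriv f v x" if "x \<in> U" for x v
    using frechet_derivative_at[OF d[OF that]] by simp
  then have "C_k_on k (dir_deriv f v) U" for v
    using C_k_on_cong[OF assms(1), of "\<lambda>x. f' x v" "dir_deriv f v" k] f'[of v] by blast
  moreover have "f differentiable_on U"
    using assms(1) d by (auto simp: differentiable_on_eq_differentiable_at differentiable_def)
  ultimately show ?thesis by simp
qed

lemma C_k_on_const: "open U \<Longrightarrow> C_k_on k (\<lambda>x. c) U"
proof (induction k arbitrary: c)
  case (Suc k)
  then show ?case by (intro C_k_on_SucI[where f' = "\<lambda>x v. 0"]) auto
qed auto

lemma C_k_on_add:
  "open U \<Longrightarrow> C_k_on k f U \<Longrightarrow> C_k_on k g U \<Longrightarrow> C_k_on k (\<lambda>x. f x + g x) U"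
proof (induction k arbitrary: f g)
  case 0
  then show ?case by (auto intro: continuous_intros)
next
  case (Suc k)
  show ?case
  proof (rule C_k_on_SucI)
    show "((\<lambda>x. f x + g x) has_derivative (\<lambda>v. dir_deriv f v x + dir_deriv g v x)) (at x)"
      if "x \<in> U" for x
      by (intro has_derivative_add C_k_on_SucD[OF _ Suc.prems(1) that]) (fact Suc.prems)+
    show "C_k_on k (\<lambda>x. dir_deriv f v x + dir_deriv g v x) U" for v
      using Suc.prems by (intro Suc.IH) auto
  qed fact
qed

lemma C_k_on_sum:
  assumes "open U" "finite I" "\<And>i. i \<in> I \<Longrightarrow> C_k_on k (f i) U"
  shows "C_k_on k (\<lambda>x. \<Sum>i\<in>I. f i x) U"
  using assms(2,3)
proof (induction I rule: finite_induct)
  case empty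
  then show ?case using assms(1) by (simp add: C_k_on_const)
next
  case (insert i I)
  then show ?case using assms(1) by (simp add: C_k_on_add)
qed

lemma (in bounded_linear) C_k_on_compose:
  "open U \<Longrightarrow> C_k_on k g U \<Longrightarrow> C_k_on k (\<lambda>x. f (g x)) U"
proof (induction k arbitrary: g)
  case 0
  then show ?case by (simp add: continuous_on)
next
  case (Suc k)
  show ?case
  proof (rule C_k_on_SucI)
    show "((\<lambda>x. f (g x)) has_derivative (\<lambda>v. f (dir_deriv g v x))) (at x)"
      if "x \<in> U" for x
      by (intro has_derivative C_k_on_SucD[OF _ Suc.prems(1) that]) (fact Suc.prems)
    show "C_k_on k (\<lambda>x. f (dir_deriv g v x)) U" for v
      using Suc.prems by (intro Suc.IH) auto
  qed fact
qed

lemma C_k_on_ident: "open U \<Longrightarrow> C_k_on k (\<lambda>x. x) U"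
  by (cases k) (auto simp: C_k_on_const)

lemma (in bounded_linear) C_k_on: "open U \<Longrightarrow> C_k_on k f U"
  using C_k_on_compose[OF _ C_k_on_ident] by simp

lemma (in bounded_bilinear) C_k_on:
  "open U \<Longrightarrow> C_k_on k f U \<Longrightarrow> C_k_on k g U \<Longrightarrow> C_k_on k (\<lambda>x. prod (f x) (g x)) U"
proof (induction k arbitrary: f g)
  case 0
  then show ?case by (simp add: continuous_on)
next
  case (Suc k)
  show ?case
  proof (rule C_k_on_SucI)
    show "((\<lambda>x. prod (f x) (g x)) has_derivative
        (\<lambda>v. prod (f x) (dir_deriv g v x) + prod (dir_deriv f v x) (g x))) (at x)"
      if "x \<in> U" for x
      by (intro FDERIV C_k_on_SucD[OF _ Suc.prems(1) that]) (fact Suc.prems)+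
    \<comment> \<open>The product rule leaves one factor undifferentiated, so its class has to be
      lowered to \<open>k\<close>.\<close>
    have "C_k_on k f U" "C_k_on k g U"
      using Suc.prems C_k_on_Suc_imp by blast+
    then show "C_k_on k (\<lambda>x. prod (f x) (dir_deriv g v x) + prod (dir_deriv f v x) (g x)) U" for v
      using Suc.prems by (intro C_k_on_add Suc.IH) auto
  qed fact
qed

text \<open>In \<open>g'(f x)(f' x v)\<close> the direction varies with \<open>x\<close>, so the
  induction hypothesis does not apply directly. Expanding \<open>f' x v\<close> in a basis leaves
  the maps \<open>g'(f x) b\<close> with \<open>b\<close> fixed, multiplied by scalar
  functions.\<close>

lemma C_k_on_compose:
  fixes f :: "'a::real_normed_vector \<Rightarrow> 'b::euclidean_space" and g :: "'b \<Rightarrow> 'c::real_normed_vector"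
  assumes "open U" "open W" and f: "f ` W \<subseteq> U"
  shows "C_k_on k g U \<Longrightarrow> C_k_on k f W \<Longrightarrow> C_k_on k (\<lambda>x. g (f x)) W"
proof (induction k arbitrary: g)
  case 0
  then show ?case using continuous_on_compose2[OF _ _ f] by simp
next
  case (Suc k)
  let ?f' = "\<lambda>x v. dir_deriv f v x" and ?g' = "\<lambda>x v. dir_deriv g v x"
  have fd: "(f has_derivative ?f' x) (at x)" if "x \<in> W" for x
    using C_k_on_SucD[OF Suc.prems(2)] assms that by auto
  have gd: "(g has_derivative ?g' (f x)) (at (f x))" if "x \<in> W" for x
    using C_k_on_SucD[OF Suc.prems(1)] assms that by auto
  show ?case
  proof (rule C_k_on_SucI[OF assms(2)])
    show "((\<lambda>x. g (f x)) has_derivative (\<lambda>v. \<Sum>b\<in>Basis. (?f' x v \<bullet> b) *\<^sub>R ?g' (f x) b)) (at x)"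
      if "x \<in> W" for x
    proof -
      have lin: "linear (?g' (f x))" using gd[OF that] has_derivative_linear by blast
      have "?g' (f x) w = (\<Sum>b\<in>Basis. (w \<bullet> b) *\<^sub>R ?g' (f x) b)" for w
        using linear_sum[OF lin, of "\<lambda>b. (w \<bullet> b) *\<^sub>R b" Basis]
        by (simp add: euclidean_representation linear_cmul[OF lin])
      then have "(\<lambda>v. \<Sum>b\<in>Basis. (?f' x v \<bullet> b) *\<^sub>R ?g' (f x) b) = (\<lambda>v. ?g' (f x) (?f' x v))"
        by (intro ext) (rule sym)
      then show ?thesis
        using has_derivative_compose[OF fd[OF that] gd[OF that]] by (simp only:)
    qed
    show "C_k_on k (\<lambda>x. \<Sum>b\<in>Basis. (?f' x v \<bullet> b) *\<^sub>R ?g' (f x) b) W" for v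
    proof (intro C_k_on_sum assms bounded_bilinear.C_k_on[OF bounded_bilinear_scaleR]
        bounded_linear.C_k_on_compose[OF bounded_linear_inner_left] Suc.IH)
      show "C_k_on k (\<lambda>x. ?f' x v) W" "\<And>b. C_k_on k (\<lambda>x. ?g' x b) U"
        using Suc.prems by auto
      show "C_k_on k f W" using C_k_on_Suc_imp Suc.prems assms by blast
    qed auto
  qed
qed

lemma frechet_derivative_symmetric:
  fixes f :: "'a::real_normed_vector \<Rightarrow> 'b::euclidean_space"
  assumes "C_k_on 2 f U" "open U" "p \<in> U"
  shows "frechet_derivative (\<lambda>x. dir_deriv f u x) (at p) v =
         frechet_derivative (\<lambda>x. dir_deriv f v x) (at p) u"
proof (rule euclidean_eqI)
  fix b :: 'b
  have C: "C_k_on (Suc (Suc 0)) f U" using assms(1) by (simp only: numeral_2_eq_2)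
  note d = C_k_on_SucD[OF C assms(2)]
  have b: "frechet_derivative (\<lambda>x. f x \<bullet> b) (at x) = (\<lambda>v. dir_deriv f v x \<bullet> b)"
    if "x \<in> U" for x
    using d[OF that] by (intro frechet_derivative_at[symmetric]) (auto intro!: derivative_eq_intros)
  have D: "((\<lambda>x. frechet_derivative (\<lambda>x. f x \<bullet> b) (at x) w) has_derivative
      (\<lambda>v. frechet_derivative (\<lambda>x. dir_deriv f w x) (at p) v \<bullet> b)) (at p)" for w
  proof (rule has_derivative_transform_within_open[OF _ assms(2,3)])
    have "C_k_on (Suc 0) (\<lambda>x. dir_deriv f w x) U" using C by auto
    from C_k_on_SucD[OF this assms(2,3)]
    show "((\<lambda>x. dir_deriv f w x \<bullet> b) has_derivative
      (\<lambda>v. frechet_derivative (\<lambda>x. dir_deriv f w x) (at p) v \<bullet> b)) (at p)"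
      by (auto intro!: derivative_eq_intros)
  qed (simp add: b)
  have "(\<lambda>x. f x \<bullet> b) differentiable at x" if "x \<in> U" for x
    using d[OF that] by (auto simp: differentiable_def intro!: derivative_eq_intros exI)
  then show "frechet_derivative (\<lambda>x. dir_deriv f u x) (at p) v \<bullet> b =
         frechet_derivative (\<lambda>x. dir_deriv f v x) (at p) u \<bullet> b"
    by (rule frechet_derivative_symmetric_real[OF assms(2,3) _ D D])
qed

subsection \<open>The Theorema Egregium\<close>

lemma frechet_derivative_inner:
  fixes f g :: "'a::real_normed_vector \<Rightarrow> 'b::real_inner"
  assumes "C_k_on (Suc k) f W" "C_k_on (Suc k) g W" "open W" "x \<in> W"
  shows "dir_deriv (\<lambda>x. f x \<bullet> g x) u x = f x \<bullet> dir_deriv g u x + dir_deriv f u x \<bullet> g x"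
proof -
  have "((\<lambda>x. f x \<bullet> g x) has_derivative (\<lambda>u. f x \<bullet> dir_deriv g u x + dir_deriv f u x \<bullet> g x)) (at x)"
    by (rule has_derivative_inner C_k_on_SucD assms)+
  from frechet_derivative_at[OF this] show ?thesis by metis
qed

text \<open>Holds without differentiability: \<open>frechet_derivative\<close> is a choice among all
  derivatives, and both maps have the same ones.\<close>

lemma frechet_derivative_cong_open:
  assumes "open W" "x \<in> W" "\<And>y. y \<in> W \<Longrightarrow> f y = g y"
  shows "frechet_derivative f (at x) = frechet_derivative g (at x)"
proof -
  have "(f has_derivative D) (at x) \<longleftrightarrow> (g has_derivative D) (at x)" for D
    using has_derivative_transform_within_open[of _ D x UNIV W] assms by metis
  then show ?thesis by (simp add: frechet_derivative_def)
qed

context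
  fixes P Q :: "'a::real_normed_vector \<Rightarrow> 'b::euclidean_space" and W :: "'a set"
  assumes W: "open W" and P: "C_k_on 3 P W" and Q: "C_k_on 3 Q W"
    and metric: "\<And>x v w. x \<in> W \<Longrightarrow> dir_deriv P v x \<bullet> dir_deriv P w x = dir_deriv Q v x \<bullet> dir_deriv Q w x"
begin

text \<open>The Koszul formula: differentiating the metric and permuting the directions isolates the
  tangential part of a second derivative.\<close>

lemma second_deriv_inner_deriv_eq:
  assumes x: "x \<in> W"
  shows "dir_deriv (dir_deriv P u) v x \<bullet> dir_deriv P w x
       = dir_deriv (dir_deriv Q u) v x \<bullet> dir_deriv Q w x"
proof -
  have P3: "C_k_on (Suc (Suc (Suc 0))) P W" and Q3: "C_k_on (Suc (Suc (Suc 0))) Q W"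
    using P Q by (simp_all only: numeral_3_eq_3)
  note P2 = C_k_on_dir_deriv[OF P3] and Q2 = C_k_on_dir_deriv[OF Q3]
  have PQ2: "C_k_on 2 P W" "C_k_on 2 Q W"
    using C_k_on_Suc_imp[OF P3 W] C_k_on_Suc_imp[OF Q3 W] by (simp_all only: numeral_2_eq_2)
  note sym = frechet_derivative_symmetric[OF PQ2(1) W x] frechet_derivative_symmetric[OF PQ2(2) W x]
  have eq: "dir_deriv P v x \<bullet> dir_deriv (dir_deriv P w) u x + dir_deriv (dir_deriv P v) u x \<bullet> dir_deriv P w x
      = dir_deriv Q v x \<bullet> dir_deriv (dir_deriv Q w) u x + dir_deriv (dir_deriv Q v) u x \<bullet> dir_deriv Q w x" for u v w
    using frechet_derivative_cong_open[OF W x, of "\<lambda>y. dir_deriv P v y \<bullet> dir_deriv P w y"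
        "\<lambda>y. dir_deriv Q v y \<bullet> dir_deriv Q w y"] metric
      frechet_derivative_inner[OF P2 P2 W x, of v w u] frechet_derivative_inner[OF Q2 Q2 W x, of v w u]
    by simp
  show ?thesis
    \<comment> \<open>The derivatives of the metric along \<open>v\<close>, \<open>u\<close> and
      \<open>w\<close>: the first two minus the third leave twice the wanted product.\<close>
    using eq[of u w v] eq[of v w u] eq[of u v w] sym[of u v] sym[of u w] sym[of v w]
    by (simp add: inner_commute)
qed

text \<open>In index notation, the third derivatives cancel in
  \<open>\<partial>\<^sub>u(P\<^sub>v\<^sub>v \<bullet> P\<^sub>u) - \<partial>\<^sub>v(P\<^sub>u\<^sub>v \<bullet> P\<^sub>u)\<close>, and both differentiated products depend only on the metric.\<close>

lemma theorema_egregium: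
  assumes x: "x \<in> W"
  shows "dir_deriv (dir_deriv P u) u x \<bullet> dir_deriv (dir_deriv P v) v x
          - dir_deriv (dir_deriv P u) v x \<bullet> dir_deriv (dir_deriv P u) v x
       = dir_deriv (dir_deriv Q u) u x \<bullet> dir_deriv (dir_deriv Q v) v x
          - dir_deriv (dir_deriv Q u) v x \<bullet> dir_deriv (dir_deriv Q u) v x"
proof -
  have *: "dir_deriv (\<lambda>y. dir_deriv (dir_deriv R v) v y \<bullet> dir_deriv R u y) u x
      - dir_deriv (\<lambda>y. dir_deriv (dir_deriv R u) v y \<bullet> dir_deriv R u y) v x
     = dir_deriv (dir_deriv R u) u x \<bullet> dir_deriv (dir_deriv R v) v x
          - dir_deriv (dir_deriv R u) v x \<bullet> dir_deriv (dir_deriv R u) v x"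
    if R: "C_k_on 3 R W" for R :: "'a \<Rightarrow> 'b"
  proof -
    have R3: "C_k_on (Suc (Suc (Suc 0))) R W"
      using R by (simp only: numeral_3_eq_3)
    note R2 = C_k_on_dir_deriv[OF R3]
    note R1 = C_k_on_dir_deriv[OF R2]
    have R2': "C_k_on 2 (dir_deriv R v) W" for v using R2 by (simp only: numeral_2_eq_2)
    have R': "C_k_on 2 R W" using C_k_on_Suc_imp[OF R3 W] by (simp only: numeral_2_eq_2)
    have R1': "C_k_on (Suc 0) (dir_deriv R v) W" for v using C_k_on_Suc_imp[OF R2 W] .
    \<comment> \<open>The third derivatives are \<open>vvu\<close> and \<open>uvv\<close>: symmetry
      for \<open>dir_deriv R v\<close> swaps the last two directions, and symmetry for
      \<open>R\<close>, valid on all of \<open>W\<close>, the first two.\<close>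
    have "dir_deriv (dir_deriv (dir_deriv R v) v) u x = dir_deriv (dir_deriv (dir_deriv R v) u) v x"
      by (rule frechet_derivative_symmetric[OF R2' W x])
    also have "\<dots> = dir_deriv (dir_deriv (dir_deriv R u) v) v x"
      using frechet_derivative_symmetric[OF R' W]
      by (intro frechet_derivative_cong_open[OF W x, THEN fun_cong]) blast
    finally show ?thesis
      using frechet_derivative_inner[OF R1 R1' W x, of v v u u] frechet_derivative_inner[OF R1 R1' W x, of u v u v]
      by (simp add: inner_commute)
  qed
  have "dir_deriv (\<lambda>y. dir_deriv (dir_deriv P u) v y \<bullet> dir_deriv P w y) z x
      = dir_deriv (\<lambda>y. dir_deriv (dir_deriv Q u) v y \<bullet> dir_deriv Q w y) z x" for u v w z
    by (intro frechet_derivative_cong_open[OF W x, THEN fun_cong] second_deriv_inner_deriv_eq)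
  then show ?thesis using *[OF P] *[OF Q] by simp
qed

end

subsection \<open>The curvature of the ellipsoid\<close>

text \<open>The factors on the left are the determinants of \<open>(x, a, b)\<close> and
  \<open>(z, a, b)\<close>. Their product is the determinant of the matrix of inner products of the
  two triples, expanded here along the row of \<open>x\<close>.\<close>

lemma cross_gram:
  fixes a b x z :: "real^3"
  shows "(x \<bullet> (a \<times> b)) * (z \<bullet> (a \<times> b)) =
    (x \<bullet> z) * ((a \<bullet> a) * (b \<bullet> b) - (a \<bullet> b)\<^sup>2)
    - (x \<bullet> a) * ((z \<bullet> a) * (b \<bullet> b) - (a \<bullet> b) * (z \<bullet> b))
    + (x \<bullet> b) * ((z \<bullet> a) * (a \<bullet> b) - (a \<bullet> a) * (z \<bullet> b))"
  by (simp add: cross3_def inner_vec_def sum_3 power2_eq_square) algebra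

lemma cross_inner_self:
  fixes a b :: "real^3"
  shows "(a \<times> b) \<bullet> (a \<times> b) = (a \<bullet> a) * (b \<bullet> b) - (a \<bullet> b)\<^sup>2"
  by (simp add: cross3_def inner_vec_def sum_3 power2_eq_square) algebra

text \<open>Apart from \<open>x \<bullet> z - y \<bullet> y\<close>, the quantity in the Theorema
  Egregium, the second derivatives enter only through products with \<open>a\<close> and
  \<open>b\<close>, which the Koszul formula controls.\<close>

lemma cross_gram_diff:
  fixes a b x y z :: "real^3"
  shows "(x \<bullet> (a \<times> b)) * (z \<bullet> (a \<times> b)) - (y \<bullet> (a \<times> b))\<^sup>2 =
    (x \<bullet> z - y \<bullet> y) * ((a \<times> b) \<bullet> (a \<times> b))
    - (x \<bullet> a) * ((z \<bullet> a) * (b \<bullet> b) - (a \<bullet> b) * (z \<bullet> b))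
    + (x \<bullet> b) * ((z \<bullet> a) * (a \<bullet> b) - (a \<bullet> a) * (z \<bullet> b))
    + (y \<bullet> a) * ((y \<bullet> a) * (b \<bullet> b) - (a \<bullet> b) * (y \<bullet> b))
    - (y \<bullet> b) * ((y \<bullet> a) * (a \<bullet> b) - (a \<bullet> a) * (y \<bullet> b))"
  unfolding power2_eq_square[of "y \<bullet> _"] cross_gram cross_inner_self by (simp only: left_diff_distrib)

text \<open>The map \<open>A\<close>; \<open>A x\<close> is half the gradient of the quadratic form
  defining the ellipsoid, hence normal to the ellipsoid at its points.\<close>

definition ellform :: "real \<Rightarrow> real \<Rightarrow> real \<Rightarrow> real^3 \<Rightarrow> real^3" where
  "ellform a0 a1 a2 x = vector [x$1 / a0, x$2 / a1, x$3 / a2]"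

text \<open>The Gaussian curvature without division: \<open>p\<close> is a point of the ellipsoid, \<open>a, b\<close> are the first
  and \<open>x, y, z\<close> the second derivatives \<open>uu, uv, vv\<close> of a parametrization. The hypotheses on them are
  the derivatives of the equation \<open>A p \<bullet> p = 1\<close>. The normal \<open>a \<times> b\<close> is a multiple of \<open>A p\<close>.\<close>

lemma ellform_gauss:
  fixes a b x y z p :: "real^3"
  assumes pos: "0 < a0" "0 < a1" "0 < a2"
  defines "A \<equiv> ellform a0 a1 a2"
  assumes "A p \<bullet> p = 1" and pa: "A p \<bullet> a = 0" and pb: "A p \<bullet> b = 0"
    and x: "A p \<bullet> x = - (A a \<bullet> a)" and y: "A p \<bullet> y = - (A a \<bullet> b)" and z: "A p \<bullet> z = - (A b \<bullet> b)"
  shows "((x \<bullet> (a \<times> b)) * (z \<bullet> (a \<times> b)) - (y \<bullet> (a \<times> b))\<^sup>2) * (a0 * a1 * a2) * (A p \<bullet> A p)\<^sup>2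
       = ((a \<times> b) \<bullet> (a \<times> b))\<^sup>2"
proof -
  let ?N = "a \<times> b" and ?e = "A p \<bullet> A p"
  have "A p \<noteq> 0" using assms(5) by auto
  then have e: "?e \<noteq> 0" by simp
  define c where "c = (?N \<bullet> A p) / ?e"
  have "A p \<times> ?N = 0"
    using pa pb by (simp add: Lagrange)
  then have "A p \<times> (?N \<times> A p) = 0" by (metis cross_skew cross_zero_right neg_equal_0_iff_equal)
  then have "?e *\<^sub>R ?N = (A p \<bullet> ?N) *\<^sub>R A p" by (simp add: Lagrange)
  then have "?N = inverse ?e *\<^sub>R (A p \<bullet> ?N) *\<^sub>R A p"
    using e by (metis scaleR_scaleR left_inverse scaleR_one)
  then have N: "?N = c *\<^sub>R A p"
    by (simp add: c_def divide_inverse inner_commute mult.commute)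
  have NN: "?N \<bullet> ?N = c\<^sup>2 * ?e" by (simp add: N power2_eq_square)
  \<comment> \<open>The left side is the inverse form of \<open>A\<close> at the normal
    \<open>c A p\<close>, that is, \<open>c\<^sup>2 (A p \<bullet> p)\<close>.\<close>
  have inv: "?N$1 * ?N$1 * a0 + ?N$2 * ?N$2 * a1 + ?N$3 * ?N$3 * a2 = c\<^sup>2"
  proof -
    have "?N$1 = c * (p$1 / a0)" "?N$2 = c * (p$2 / a1)" "?N$3 = c * (p$3 / a2)"
      unfolding N by (simp_all add: A_def ellform_def)
    then have "?N$1 * ?N$1 * a0 = c\<^sup>2 * (p$1 / a0 * p$1)" "?N$2 * ?N$2 * a1 = c\<^sup>2 * (p$2 / a1 * p$2)"
      "?N$3 * ?N$3 * a2 = c\<^sup>2 * (p$3 / a2 * p$3)"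
      using pos by (simp_all add: power2_eq_square)
    then have "?N$1 * ?N$1 * a0 + ?N$2 * ?N$2 * a1 + ?N$3 * ?N$3 * a2 = c\<^sup>2 * (A p \<bullet> p)"
      by (simp add: A_def ellform_def inner_vec_def sum_3 distrib_left)
    then show ?thesis using assms(5) by simp
  qed
  \<comment> \<open>Cauchy-Binet: the Gram determinant of \<open>a, b\<close> under \<open>A\<close>
    is a weighted sum of squares of the components of \<open>a \<times> b\<close>, and the factor
    \<open>a0 a1 a2\<close> turns the weights into those of the inverse form.\<close>
  have "((A a \<bullet> a) * (A b \<bullet> b) - (A a \<bullet> b)\<^sup>2) * (a0 * a1 * a2)
     = ?N$1 * ?N$1 * a0 + ?N$2 * ?N$2 * a1 + ?N$3 * ?N$3 * a2"
    using pos unfolding A_def ellform_def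
    apply (simp add: cross3_def inner_vec_def sum_3 power2_eq_square divide_simps)
    by algebra
  then have "((A a \<bullet> a) * (A b \<bullet> b) - (A a \<bullet> b)\<^sup>2) * (a0 * a1 * a2) = c\<^sup>2" using inv by simp
  moreover have "x \<bullet> ?N = - c * (A a \<bullet> a)" "y \<bullet> ?N = - c * (A a \<bullet> b)" "z \<bullet> ?N = - c * (A b \<bullet> b)"
    using x y z by (simp_all add: N inner_commute)
  ultimately show ?thesis unfolding NN by algebra
qed

lemma bounded_linear_ellform: "bounded_linear (ellform a0 a1 a2)"
  by (intro linear_conv_bounded_linear[THEN iffD1] linearI)
    (simp_all add: ellform_def vec_eq_iff forall_3 add_divide_distrib)

lemma ellform_inner_commute: "ellform a0 a1 a2 x \<bullet> y = ellform a0 a1 a2 y \<bullet> x"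
  by (simp add: ellform_def inner_vec_def sum_3 mult.commute)

lemma mem_ellipsoid_iff: "x \<in> ellipsoid a0 a1 a2 \<longleftrightarrow> ellform a0 a1 a2 x \<bullet> x = 1"
  by (simp add: ellipsoid_def ellform_def inner_vec_def sum_3 power2_eq_square)

text \<open>As \<open>A\<close> is symmetric, differentiating \<open>A P \<bullet> P = 1\<close>
  gives twice the first product; differentiating once more gives the second. These are the
  hypotheses of \<open>ellform_gauss\<close>.\<close>

lemma ellipsoid_derivs:
  fixes P :: "'a::real_normed_vector \<Rightarrow> real^3"
  assumes W: "open W" and x: "x \<in> W" and P: "C_k_on 2 P W" and E: "P ` W \<subseteq> ellipsoid a0 a1 a2"
  defines "A \<equiv> ellform a0 a1 a2"
  shows "A (P x) \<bullet> dir_deriv P u x = 0"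
    and "A (P x) \<bullet> dir_deriv (dir_deriv P u) v x = - (A (dir_deriv P u x) \<bullet> dir_deriv P v x)"
proof -
  interpret A: bounded_linear A unfolding A_def by (rule bounded_linear_ellform)
  have P2: "C_k_on (Suc (Suc 0)) P W" using P by (simp only: numeral_2_eq_2)
  note AP2 = A.C_k_on_compose[OF W P2]
  have P1: "C_k_on (Suc 0) P W" "C_k_on (Suc 0) (\<lambda>x. A (P x)) W"
    using C_k_on_Suc_imp[OF P2 W] C_k_on_Suc_imp[OF AP2 W] .
  have dA: "dir_deriv (\<lambda>x. A (P x)) u y = A (dir_deriv P u y)" if "y \<in> W" for u y
    using frechet_derivative_at[OF A.has_derivative[OF C_k_on_SucD[OF P2 W that]]] by metis
  have 1: "A (P y) \<bullet> dir_deriv P u y = 0" if y: "y \<in> W" for u y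
  proof -
    have "dir_deriv (\<lambda>y. A (P y) \<bullet> P y) u y = dir_deriv (\<lambda>y. 1) u y"
      using E by (intro frechet_derivative_cong_open[OF W y, THEN fun_cong]) (auto simp: mem_ellipsoid_iff A_def)
    then show ?thesis
      using frechet_derivative_inner[OF AP2 P2 W y, of u] dA[OF y, of u]
        ellform_inner_commute[of a0 a1 a2 "dir_deriv P u y"]
      by (simp add: A_def)
  qed
  show "A (P x) \<bullet> dir_deriv P u x = 0" by (rule 1[OF x])
  have "dir_deriv (\<lambda>y. A (P y) \<bullet> dir_deriv P u y) v x = dir_deriv (\<lambda>y. 0) v x"
    using 1 by (intro frechet_derivative_cong_open[OF W x, THEN fun_cong]) auto
  then show "A (P x) \<bullet> dir_deriv (dir_deriv P u) v x = - (A (dir_deriv P u x) \<bullet> dir_deriv P v x)"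
    using frechet_derivative_inner[OF P1(2) C_k_on_dir_deriv[OF P2] W x, of u v] dA[OF x, of v]
      ellform_inner_commute[of a0 a1 a2 "dir_deriv P u x"]
    by (simp add: A_def)
qed

lemma ellipsoid_invariant:
  fixes P Q :: "'a::real_normed_vector \<Rightarrow> real^3"
  assumes pos: "0 < a0" "0 < a1" "0 < a2"
    and W: "open W" and x: "x \<in> W" and P: "C_k_on 3 P W" and Q: "C_k_on 3 Q W"
    and EP: "P ` W \<subseteq> ellipsoid a0 a1 a2" and EQ: "Q ` W \<subseteq> ellipsoid a0 a1 a2"
    and metric: "\<And>y v w. y \<in> W \<Longrightarrow> dir_deriv P v y \<bullet> dir_deriv P w y = dir_deriv Q v y \<bullet> dir_deriv Q w y"
    and reg: "dir_deriv P u x \<times> dir_deriv P v x \<noteq> 0"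
  defines "A \<equiv> ellform a0 a1 a2"
  shows "A (P x) \<bullet> A (P x) = A (Q x) \<bullet> A (Q x)"
proof -
  \<comment> \<open>\<open>M R / (G R)\<^sup>2\<close> is the Gaussian curvature; by \<open>cross_gram_diff\<close> its numerator involves
    the second derivatives only through products that the metric determines.\<close>
  define M where "M R = (dir_deriv (dir_deriv R u) u x \<bullet> (dir_deriv R u x \<times> dir_deriv R v x)) *
    (dir_deriv (dir_deriv R v) v x \<bullet> (dir_deriv R u x \<times> dir_deriv R v x)) -
    (dir_deriv (dir_deriv R u) v x \<bullet> (dir_deriv R u x \<times> dir_deriv R v x))\<^sup>2"
    for R :: "'a \<Rightarrow> real^3"
  define G where "G R = (dir_deriv R u x \<times> dir_deriv R v x) \<bullet> (dir_deriv R u x \<times> dir_deriv R v x)"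
    for R :: "'a \<Rightarrow> real^3"
  have K: "M R * (a0 * a1 * a2) * (A (R x) \<bullet> A (R x))\<^sup>2 = (G R)\<^sup>2"
    if R: "C_k_on 3 R W" and ER: "R ` W \<subseteq> ellipsoid a0 a1 a2" for R
  proof -
    have "C_k_on (Suc 2) R W" using R by simp
    then have R2: "C_k_on 2 R W" using C_k_on_Suc_imp W by blast
    have "A (R x) \<bullet> R x = 1" using ER x by (auto simp: A_def mem_ellipsoid_iff[symmetric])
    then show ?thesis unfolding M_def G_def A_def
      by (intro ellform_gauss pos) (simp_all add: ellipsoid_derivs[OF W x R2 ER])
  qed
  note h = theorema_egregium[OF W P Q metric x]
  note t = second_deriv_inner_deriv_eq[OF W P Q metric x]
  have "G P = G Q" unfolding G_def cross_inner_self using metric[OF x] by simp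
  moreover have "M P = M Q"
    unfolding M_def cross_gram_diff G_def[symmetric]
    using \<open>G P = G Q\<close> h t metric[OF x] by (simp only:)
  moreover have "G P \<noteq> 0" using reg by (simp add: G_def)
  \<comment> \<open>Since \<open>G P\<close> is nonzero, \<open>K\<close> forces the common factor
    \<open>M P * (a0 * a1 * a2)\<close> to be nonzero, so it cancels.\<close>
  ultimately have "(A (P x) \<bullet> A (P x))\<^sup>2 = (A (Q x) \<bullet> A (Q x))\<^sup>2"
    using K[OF P EP] K[OF Q EQ]
    by (metis mult_cancel_left mult_zero_left zero_eq_power2)
  then show ?thesis by (simp add: power2_eq_iff_nonneg)
qed

subsection \<open>Tables on the ellipsoid\<close>

lemma C_k_on_sin_cos: "open U \<Longrightarrow> C_k_on k (sin :: real \<Rightarrow> real) U \<and> C_k_on k (cos :: real \<Rightarrow> real) U"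
proof (induction k)
  case 0
  then show ?case by (auto intro: continuous_intros)
next
  case (Suc k)
  have "C_k_on (Suc k) (sin :: real \<Rightarrow> real) U"
  proof (rule C_k_on_SucI[OF Suc.prems])
    show "(sin has_derivative (\<lambda>v. v * cos x)) (at x)" for x :: real
      by (auto intro!: derivative_eq_intros)
    show "C_k_on k (\<lambda>x. v * cos x) U" for v
      by (rule bounded_linear.C_k_on_compose[OF bounded_linear_mult_right]) (use Suc in auto)
  qed
  moreover have "C_k_on (Suc k) (cos :: real \<Rightarrow> real) U"
  proof (rule C_k_on_SucI[OF Suc.prems])
    show "(cos has_derivative (\<lambda>v. (- v) * sin x)) (at x)" for x :: real
      by (auto intro!: derivative_eq_intros)
    show "C_k_on k (\<lambda>x. (- v) * sin x) U" for v
      by (rule bounded_linear.C_k_on_compose[OF bounded_linear_mult_right]) (use Suc in auto)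
  qed
  ultimately show ?case by blast
qed

text \<open>Longitude and latitude, with the origin sent to the vertex \<open>axis 1 r0\<close>. A
  negative \<open>r0\<close> gives the opposite vertex, so one chart serves both halves.\<close>

definition ellipsoid_chart :: "real \<Rightarrow> real \<Rightarrow> real \<Rightarrow> real \<times> real \<Rightarrow> real^3" where
  "ellipsoid_chart r0 r1 r2 x =
     (cos (fst x) * cos (snd x)) *\<^sub>R axis 1 r0 + (sin (fst x) * cos (snd x)) *\<^sub>R axis 2 r1 +
     sin (snd x) *\<^sub>R axis 3 r2"

lemma ellipsoid_chart_nth [simp]:
  "ellipsoid_chart r0 r1 r2 x $ 1 = cos (fst x) * cos (snd x) * r0"
  "ellipsoid_chart r0 r1 r2 x $ 2 = sin (fst x) * cos (snd x) * r1"
  "ellipsoid_chart r0 r1 r2 x $ 3 = sin (snd x) * r2"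
  by (simp_all add: ellipsoid_chart_def axis_def)

lemma ellipsoid_chart_in_ellipsoid:
  assumes "r0 \<noteq> 0" "r1 \<noteq> 0" "r2 \<noteq> 0"
  shows "ellipsoid_chart r0 r1 r2 x \<in> ellipsoid (r0\<^sup>2) (r1\<^sup>2) (r2\<^sup>2)"
proof -
  have "(cos (fst x))\<^sup>2 * (cos (snd x))\<^sup>2 + (sin (fst x))\<^sup>2 * (cos (snd x))\<^sup>2 + (sin (snd x))\<^sup>2
      = ((cos (fst x))\<^sup>2 + (sin (fst x))\<^sup>2) * (cos (snd x))\<^sup>2 + (sin (snd x))\<^sup>2"
    by (simp only: distrib_right)
  also have "\<dots> = 1" by simp
  finally show ?thesis
    using assms by (simp add: ellipsoid_def power_mult_distrib)
qed

lemma C_k_on_ellipsoid_chart: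
  assumes "open U"
  shows "C_k_on k (ellipsoid_chart r0 r1 r2) U"
proof -
  have h: "C_k_on k h UNIV" if "h \<in> {sin, cos}" for h :: "real \<Rightarrow> real"
    using that C_k_on_sin_cos[of UNIV k] by auto
  have f: "C_k_on k (\<lambda>x :: real \<times> real. h (fst x)) U" if "h \<in> {sin, cos}" for h :: "real \<Rightarrow> real"
    by (rule C_k_on_compose[of UNIV U fst k h, OF _ assms _ h[OF that]
          bounded_linear.C_k_on[OF bounded_linear_fst assms]]) simp_all
  have s: "C_k_on k (\<lambda>x :: real \<times> real. h (snd x)) U" if "h \<in> {sin, cos}" for h :: "real \<Rightarrow> real"
    by (rule C_k_on_compose[of UNIV U snd k h, OF _ assms _ h[OF that]
          bounded_linear.C_k_on[OF bounded_linear_snd assms]]) simp_all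
  have *: "C_k_on k (\<lambda>x. h (fst x) * h' (snd x)) U" if "h \<in> {sin, cos}" "h' \<in> {sin, cos}"
    for h h' :: "real \<Rightarrow> real"
    by (rule bounded_bilinear.C_k_on[OF bounded_bilinear_mult assms f[OF that(1)] s[OF that(2)]])
  note scaleR = bounded_linear.C_k_on_compose[OF bounded_linear_scaleR_left assms]
  show ?thesis unfolding ellipsoid_chart_def[abs_def]
    by (rule C_k_on_add[OF assms C_k_on_add[OF assms scaleR[OF *] scaleR[OF *]] scaleR[OF s]]) simp_all
qed

lemma ellipsoid_chart_deriv_0:
  "dir_deriv (ellipsoid_chart r0 r1 r2) (s, t) (0, 0) = s *\<^sub>R axis 2 r1 + t *\<^sub>R axis 3 r2"
proof -
  have "(ellipsoid_chart r0 r1 r2 has_derivative (\<lambda>v. fst v *\<^sub>R axis 2 r1 + snd v *\<^sub>R axis 3 r2)) (at (0, 0))"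
    unfolding ellipsoid_chart_def[abs_def]
    by (rule has_derivative_eq_rhs, (rule derivative_intros)+) (simp add: fun_eq_iff)
  from frechet_derivative_at[OF this, symmetric] show ?thesis by simp
qed

section \<open>Pulling the metric back along an isometry\<close>

text \<open>The vector is the initial velocity of \<open>F (x + t v)\<close>, which stays in
  \<open>S\<close> for small \<open>t\<close> and is smooth on an open interval around
  \<open>0\<close>.\<close>

lemma dir_deriv_in_tangent_space:
  fixes F :: "'a::euclidean_space \<Rightarrow> 'b::real_normed_vector"
  assumes W: "open W" and F: "smooth_on_open F W" and S: "F ` W \<subseteq> S" and x: "x \<in> W"
  shows "dir_deriv F v x \<in> tangent_space S (F x)"
proof -
  define c where "c t = F (x + t *\<^sub>R v)" for t
  define V where "V = (\<lambda>t :: real. x + t *\<^sub>R v) -` W"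
  have V: "open V" unfolding V_def by (intro open_vimage W continuous_intros)
  have "0 \<in> V" using x by (simp add: V_def)
  then obtain e where e: "e > 0" "ball 0 e \<subseteq> V" using V openE by blast
  have iV: "{0..<e} \<subseteq> V" using e by (auto simp: subset_iff dist_real_def)
  have "smooth_on_open c V"
    unfolding smooth_on_open_def
  proof
    fix k
    show "C_k_on k c V"
      unfolding c_def[abs_def]
      by (rule C_k_on_compose[OF W V])
        (use F V in \<open>auto simp: V_def smooth_on_open_def intro!: C_k_on_add C_k_on_const
          bounded_linear.C_k_on[OF bounded_linear_scaleR_left]\<close>)
  qed
  then have sm: "smooth_map_on {0..<e} c"
    unfolding smooth_map_on_def using V iV by blast
  have "C_k_on (Suc 0) F W" using F by (simp only: smooth_on_open_def)
  from C_k_on_SucD[OF this W x]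
  have D: "(F has_derivative frechet_derivative F (at x)) (at (x + 0 *\<^sub>R v))" by simp
  have "((\<lambda>t. F (x + t *\<^sub>R v)) has_derivative (\<lambda>t. frechet_derivative F (at x) (t *\<^sub>R v))) (at 0)"
    by (rule has_derivative_compose[where f = "\<lambda>t. x + t *\<^sub>R v" and g = F, OF _ D])
      (auto intro!: derivative_eq_intros)
  then have "(c has_vector_derivative dir_deriv F v x) (at 0)"
    unfolding c_def[abs_def] has_vector_derivative_def
    by (simp add: linear_cmul[OF has_derivative_linear[OF D]])
  then have "(c has_vector_derivative dir_deriv F v x) (at 0 within {0..<e})"
    by (rule has_vector_derivative_at_within)
  moreover have "c ` {0..<e} \<subseteq> S" using iV S by (auto simp: c_def V_def)
  moreover have "c 0 = F x" by (simp add: c_def)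
  ultimately show ?thesis unfolding tangent_space_def using e(1) sm
    by (intro span_base) blast
qed

text \<open>As \<open>F\<close> maps into \<open>S\<close>, the chain rule works with any derivative
  \<open>D\<close> of \<open>f\<close> within \<open>S\<close>, and \<open>D\<close> is evaluated
  only on tangent vectors, where it preserves inner products.\<close>

lemma riemannian_isometry_pullback_metric:
  fixes F :: "'a::euclidean_space \<Rightarrow> 'b::real_inner" and f :: "'b \<Rightarrow> 'c::real_inner"
  assumes f: "riemannian_isometry S T f"
    and W: "open W" and F: "smooth_on_open F W" and S: "F ` W \<subseteq> S" and x: "x \<in> W"
  shows "dir_deriv F v x \<bullet> dir_deriv F w x = dir_deriv (\<lambda>y. f (F y)) v x \<bullet> dir_deriv (\<lambda>y. f (F y)) w x"
proof -
  have "F x \<in> S" using S x by blast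
  note bspec[OF conjunct2[OF f[unfolded riemannian_isometry_def]] this]
  then obtain D where D: "(f has_derivative D) (at (F x) within S)"
    and iso: "\<forall>v\<in>tangent_space S (F x). \<forall>w\<in>tangent_space S (F x). D v \<bullet> D w = v \<bullet> w"
    by (elim exE conjE)
  have "C_k_on (Suc 0) F W" using F by (simp only: smooth_on_open_def)
  from C_k_on_SucD[OF this W x]
  have "(F has_derivative frechet_derivative F (at x)) (at x within W)"
    by (rule has_derivative_at_withinI)
  from has_derivative_in_compose[OF this has_derivative_subset[OF D S]]
  have "((\<lambda>y. f (F y)) has_derivative (\<lambda>v. D (dir_deriv F v x))) (at x)"
    by (simp only: at_within_open[OF x W])
  from frechet_derivative_at[OF this, symmetric]
  have "dir_deriv (\<lambda>y. f (F y)) v x = D (dir_deriv F v x)" for v by simp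
  then show ?thesis using iso dir_deriv_in_tangent_space[OF W F S x] by (simp only:)
qed

section \<open>The vertex of least curvature\<close>

text \<open>The set \<open>Z\<close> expresses that \<open>X\<close> contains a full neighbourhood
  of the vertex in the ellipsoid, so the chart can be composed with an isometry near the
  origin.\<close>

lemma ellipsoid_tables_not_isometric:
  fixes a0 a1 a2 r0 :: real and X Y Z :: "(real^3) set"
  assumes a: "0 < a0" "a0 < a1" "a1 < a2" and r0: "r0\<^sup>2 = a0"
    and X: "ellipsoid a0 a1 a2 \<inter> Z \<subseteq> X" and Z: "open Z" "axis 1 r0 \<in> Z"
    and Y: "Y \<subseteq> ellipsoid a0 a1 a2" "\<And>y. y \<in> Y \<Longrightarrow> y $ 3 \<noteq> 0"
  shows "\<not> riemannian_isometric X Y"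
proof
  assume "riemannian_isometric X Y"
  then obtain f where f: "riemannian_isometry X Y f" unfolding riemannian_isometric_def by blast
  then have bij: "bij_betw f X Y" and sm: "smooth_map_on X f"
    unfolding riemannian_isometry_def diffeomorphism_betw_def by auto
  define r1 r2 where "r1 = sqrt a1" and "r2 = sqrt a2"
  have r: "r0 \<noteq> 0" "r1 > 0" "r2 > 0" "r1\<^sup>2 = a1" "r2\<^sup>2 = a2"
    using a r0 by (auto simp: r1_def r2_def)
  define F where "F = ellipsoid_chart r0 r1 r2"
  have F0: "F (0, 0) = axis 1 r0"
    by (simp add: F_def ellipsoid_chart_def)
  have FE: "F x \<in> ellipsoid a0 a1 a2" for x
    using ellipsoid_chart_in_ellipsoid[of r0 r1 r2 x] r r0 by (simp add: F_def)
  have "axis 1 r0 \<in> X" using FE[of "(0, 0)"] X Z F0 by auto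
  note bspec[OF sm[unfolded smooth_map_on_def] this]
  then obtain U g where U: "open U" "axis 1 r0 \<in> U" and g: "smooth_on_open g U"
    and gf: "\<forall>x\<in>X \<inter> U. g x = f x"
    by (elim exE conjE)
  have CF: "C_k_on k F V" if "open V" for k V
    unfolding F_def by (rule C_k_on_ellipsoid_chart[OF that])
  \<comment> \<open>On \<open>W\<close> the chart lands in \<open>X\<close> because of
    \<open>Z\<close>, and the smooth extension \<open>g\<close> of \<open>f\<close> is available
    because of \<open>U\<close>. Hence \<open>f\<close> after \<open>F\<close> is of class
    \<open>C\<^sup>3\<close>.\<close>
  define W where "W = F -` (U \<inter> Z)"
  have W: "open W"
    using CF[of UNIV 0] unfolding W_def by (intro open_vimage open_Int U Z) simp
  have W0: "(0, 0) \<in> W" using F0 U Z by (simp add: W_def)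
  have FX: "F ` W \<subseteq> X" using FE X by (auto simp: W_def)
  define Q where "Q x = f (F x)" for x
  have gQ: "g (F x) = Q x" if "x \<in> W" for x
    using bspec[OF gf, of "F x"] FX that by (auto simp: W_def Q_def)
  have "C_k_on 3 (\<lambda>x. g (F x)) W"
    by (rule C_k_on_compose[OF U(1) W]) (use g CF[OF W] in \<open>auto simp: smooth_on_open_def W_def\<close>)
  then have CQ: "C_k_on 3 Q W" using C_k_on_cong[OF W, of "\<lambda>x. g (F x)" Q 3] gQ by simp
  have QY: "Q x \<in> Y" if "x \<in> W" for x
    using FX that bij bij_betw_apply[of f X Y "F x"] by (auto simp: Q_def)
  have "dir_deriv F (1, 0) (0, 0) \<times> dir_deriv F (0, 1) (0, 0) = axis 1 (r1 * r2)"
    by (simp add: F_def ellipsoid_chart_deriv_0 cross3_def vec_eq_iff forall_3 axis_def)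
  then have reg: "dir_deriv F (1, 0) (0, 0) \<times> dir_deriv F (0, 1) (0, 0) \<noteq> 0"
    using r by (simp add: axis_eq_0_iff)
  have metric: "dir_deriv F v y \<bullet> dir_deriv F w y = dir_deriv Q v y \<bullet> dir_deriv Q w y" if "y \<in> W" for y v w
    unfolding Q_def[abs_def]
    by (rule riemannian_isometry_pullback_metric[OF f W _ FX that]) (simp add: smooth_on_open_def CF W)
  define q where "q = Q (0, 0)"
  have q: "q \<in> ellipsoid a0 a1 a2" "q $ 3 \<noteq> 0" using QY[OF W0] Y by (auto simp: q_def)
  have "ellform a0 a1 a2 (F (0, 0)) \<bullet> ellform a0 a1 a2 (F (0, 0)) = ellform a0 a1 a2 q \<bullet> ellform a0 a1 a2 q"
    unfolding q_def
  proof (rule ellipsoid_invariant[OF _ _ _ W W0 CF[OF W] CQ _ _ metric reg])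
    show "F ` W \<subseteq> ellipsoid a0 a1 a2" using FE by blast
    show "Q ` W \<subseteq> ellipsoid a0 a1 a2" using QY Y by blast
  qed (use a in auto)
  moreover have "ellform a0 a1 a2 (F (0, 0)) \<bullet> ellform a0 a1 a2 (F (0, 0)) = 1 / a0"
    unfolding F0 using a r0 by (simp add: ellform_def inner_vec_def sum_3 axis_def power2_eq_square divide_simps)
  \<comment> \<open>The left side averages \<open>1 / a0\<close>, \<open>1 / a1\<close>,
    \<open>1 / a2\<close> with the weights \<open>(q$i)\<^sup>2 / a\<close> that sum to 1. The last
    weight is positive as \<open>q $ 3\<close> is nonzero, so the average lies strictly below the
    maximum.\<close>
  moreover have "ellform a0 a1 a2 q \<bullet> ellform a0 a1 a2 q < 1 / a0"
  proof -
    have 1: "(q$1)\<^sup>2 / a0 + (q$2)\<^sup>2 / a1 + (q$3)\<^sup>2 / a2 = 1" using q by (simp add: ellipsoid_def)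
    have "(q$2)\<^sup>2 / a1 * (1 / a1) \<le> (q$2)\<^sup>2 / a1 * (1 / a0)"
      using a by (intro mult_left_mono) (auto simp: frac_le)
    moreover have "(q$3)\<^sup>2 / a2 * (1 / a2) < (q$3)\<^sup>2 / a2 * (1 / a0)"
      using a q by (intro mult_strict_left_mono) (auto simp: frac_less2)
    ultimately have "(q$1)\<^sup>2 / a0 * (1 / a0) + (q$2)\<^sup>2 / a1 * (1 / a1) + (q$3)\<^sup>2 / a2 * (1 / a2)
       < ((q$1)\<^sup>2 / a0 + (q$2)\<^sup>2 / a1 + (q$3)\<^sup>2 / a2) * (1 / a0)"
      unfolding distrib_right by linarith
    then show ?thesis unfolding 1
      by (simp add: ellform_def inner_vec_def sum_3 power2_eq_square)
  qed
  ultimately show False by simp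
qed

theorem corollary1:
  fixes a0 a1 a2 l m :: real and X Y :: "(real^3) set"
  assumes "0 < a0" and "a0 < a1" and "a1 < a2"
    and "l \<in> {a0<..<a1}" and "m \<in> {a1<..<a2}"
    and "X \<in> first_type_tables a0 a1 a2 l"
    and "Y \<in> second_type_tables a0 a1 a2 m"
  shows "\<not> riemannian_isometric X Y"
proof -
  \<comment> \<open>The sign of the half that \<open>X\<close> is, so that both halves are treated
    at once.\<close>
  define s :: real where "s = (if X = {x \<in> ellipsoid a0 a1 a2. confocal_form a0 a1 a2 l x \<le> 1 \<and> x$1 > 0} then 1 else - 1)"
  have X: "X = {x \<in> ellipsoid a0 a1 a2. confocal_form a0 a1 a2 l x \<le> 1 \<and> s * x$1 > 0}"
    using assms(6) unfolding first_type_tables_def s_def by auto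
  define Z where "Z = {x. confocal_form a0 a1 a2 l x < 1 \<and> 0 < s * x$1}"
  show ?thesis
  proof (rule ellipsoid_tables_not_isometric[OF assms(1-3)])
    show "(s * sqrt a0)\<^sup>2 = a0" using assms(1) by (simp add: s_def power_mult_distrib)
    show "ellipsoid a0 a1 a2 \<inter> Z \<subseteq> X" by (auto simp: X Z_def)
    show "open Z" unfolding Z_def confocal_form_def
      using assms(3,4) by (intro open_Collect_conj open_Collect_less continuous_intros) auto
    \<comment> \<open>This is the confocal form at the vertex; it is negative because
      \<open>l > a0\<close>.\<close>
    have "a0 / (a0 - l) < 1" using assms(1,4) by (simp add: divide_simps)
    then show "axis 1 (s * sqrt a0) \<in> Z"
      using assms(1) by (simp add: Z_def confocal_form_def axis_def power_mult_distrib s_def)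
    show "Y \<subseteq> ellipsoid a0 a1 a2" "\<And>y. y \<in> Y \<Longrightarrow> y $ 3 \<noteq> 0"
      using assms(7) unfolding second_type_tables_def by auto
  qed
qed

end
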